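(* There is an absolute constant $C>0$ such that for every prime power $q$, all integers $n\geq 1$ and $0\leq k\leq n$, every nonempty set $E\subseteq\mathbb{F}_q^n$ and every real $u$ with $0<u\leq\frac14\min\{q^k,|E|\}$, $$|\{V\in G(k,n): |\pi_V(E)|\leq u\}|\leq C\,\frac{u\,q^{k(n-k)}}{\max\{|E|,q^k\}}.$$ In particular, for fixed $n,k$, if for each $q$ (ranging over an infinite set of prime powers, $q\to\infty$) we are given a nonempty $E=E_q\subseteq\mathbb{F}_q^n$ and $u=u_q$ with $0<u\leq\frac14\min\{q^k,|E|\}$ and $u=o(\max\{|E|,q^k\})$, then $$|\{V\in G(k,n): |\pi_V(E)|\leq u\}|=o(|G(k,n)|).$$
   Context: $\mathbb{F}_q$ is the finite field with $q$ elements and $|X|$ is the cardinality of a finite set $X$. $G(k,n)$ is the set of all $k$-dimensional linear subspaces of $\mathbb{F}_q^n$. For a subspace $V$, $V^\perp=\{y\in\mathbb{F}_q^n: x\cdot y=0 \text{ for all } x\in V\}$, where $x\cdot y$ is the usual dot product. The projection of $E\subseteq\mathbb{F}_q^n$ onto $V$ is the set of cosets $$\pi_V(E)=\{x+V^\perp: x\in\mathbb{F}_q^n,\ (x+V^\perp)\cap E\neq\varnothing\}.$$ For non-negative functions $f,g$ of $q$, $f=o(g)$ means $f/g\to0$ as $q\to\infty$. *)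

theory Defs
  imports
    Complex_Main
    "HOL-Number_Theory.Prime_Powers"
    "HOL-Algebra.Algebra"
    "Jordan_Normal_Form.Missing_VectorSpace"
begin

text \<open>
  A finite field is given by a record on the type \<^typ>\<open>nat\<close>, so that an absolute constant can be
  quantified before the field. This loses no generality:
\<close>

lemma finite_field_nat_copy:
  fixes R :: "'a ring"
  assumes "field R" and "finite (carrier R)"
  shows "\<exists>F :: nat ring. field F \<and> card (carrier F) = card (carrier R) \<and> R \<simeq> F"
proof -
  interpret field R by fact
  obtain f :: "'a \<Rightarrow> nat" where f: "inj_on f (carrier R)"
    using finite_imp_inj_to_nat_seg[OF assms(2)] by auto
  have c: "carrier (image_ring f R) = f ` carrier R"
    by (simp add: image_ring_carrier)
  have "field (image_ring f R)"
    by (rule inj_imp_image_ring_is_field[OF f])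
  moreover have "card (carrier (image_ring f R)) = card (carrier R)"
    by (simp add: c card_image[OF f])
  moreover have "R \<simeq> image_ring f R"
    using inj_imp_image_ring_iso[OF f] unfolding is_ring_iso_def by auto
  moreover have "\<exists>F :: nat ring. F = image_ring f R" by simp
  ultimately show ?thesis by metis
qed

definition GF :: "nat \<Rightarrow> ('a, 'b) ring_scheme \<Rightarrow> bool" where
  "GF q F \<longleftrightarrow> primepow q \<and> field F \<and> card (carrier F) = q"

abbreviation coord_space :: "('a, 'b) ring_scheme \<Rightarrow> nat \<Rightarrow> ('a, nat \<Rightarrow> 'a) module" where
  "coord_space F n \<equiv> ring.func_space F {..<n}"

lemma coord_space_vectorspace:
  assumes "field F"
  shows "vectorspace F (coord_space F n)"
proof -
  interpret field F by fact
  show ?thesis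
    by (intro vectorspace.intro func_space_is_module assms)
qed

definition dot :: "('a, 'b) ring_scheme \<Rightarrow> nat \<Rightarrow> (nat \<Rightarrow> 'a) \<Rightarrow> (nat \<Rightarrow> 'a) \<Rightarrow> 'a" where
  "dot F n x y = (\<Oplus>\<^bsub>F\<^esub>i\<in>{..<n}. x i \<otimes>\<^bsub>F\<^esub> y i)"

definition Grassmannian :: "('a, 'b) ring_scheme \<Rightarrow> nat \<Rightarrow> nat \<Rightarrow> (nat \<Rightarrow> 'a) set set" where
  "Grassmannian F k n =
     {V. VectorSpace.subspace F V (coord_space F n) \<and>
         vectorspace.dim F ((coord_space F n)\<lparr>carrier := V\<rparr>) = k}"

definition perp :: "('a, 'b) ring_scheme \<Rightarrow> nat \<Rightarrow> (nat \<Rightarrow> 'a) set \<Rightarrow> (nat \<Rightarrow> 'a) set" where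
  "perp F n V = {y \<in> carrier (coord_space F n). \<forall>x\<in>V. dot F n x y = \<zero>\<^bsub>F\<^esub>}"

definition proj ::
  "('a, 'b) ring_scheme \<Rightarrow> nat \<Rightarrow> (nat \<Rightarrow> 'a) set \<Rightarrow> (nat \<Rightarrow> 'a) set \<Rightarrow> (nat \<Rightarrow> 'a) set set" where
  "proj F n V E =
     {x <+\<^bsub>coord_space F n\<^esub> perp F n V | x.
        x \<in> carrier (coord_space F n) \<and> (x <+\<^bsub>coord_space F n\<^esub> perp F n V) \<inter> E \<noteq> {}}"

definition small_proj ::
  "('a, 'b) ring_scheme \<Rightarrow> nat \<Rightarrow> nat \<Rightarrow> (nat \<Rightarrow> 'a) set \<Rightarrow> real \<Rightarrow> (nat \<Rightarrow> 'a) set set" where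
  "small_proj F k n E u = {V \<in> Grassmannian F k n. real (card (proj F n V E)) \<le> u}"

text \<open>\<open>f = o(g)\<close> as \<open>q \<rightarrow> \<infinity>\<close> with \<open>q\<close> restricted to the index set \<open>Q\<close>.\<close>

definition little_o_on :: "nat set \<Rightarrow> (nat \<Rightarrow> real) \<Rightarrow> (nat \<Rightarrow> real) \<Rightarrow> bool" where
  "little_o_on Q f g \<longleftrightarrow> ((\<lambda>q. f q / g q) \<longlongrightarrow> 0) (inf at_top (principal Q))"

end

theory Submission
  imports Defs "HOL-Analysis.Convex"
begin

text \<open>
  Count the pairs of points of \<open>E\<close> whose difference lies in \<open>V\<^sup>\<bottom>\<close>. By Cauchy--Schwarz there are at
  least \<open>|E|\<^sup>2 / |\<pi>\<^sub>V(E)|\<close> of them, hence at least \<open>|E|\<^sup>2 / u\<close> for an exceptional \<open>V\<close>, and for every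
  \<open>V\<close> at least \<open>|E|\<close> (the diagonal) and at least \<open>|E|\<^sup>2 / q\<^sup>k\<close>. A nonzero vector lies in \<open>V\<^sup>\<bottom>\<close> for a
  proportion of at most \<open>q\<^sup>-\<^sup>k\<close> of all \<open>V \<in> G(k,n)\<close>, so the total number of pairs over all \<open>V\<close> is at
  most \<open>|G(k,n)| (|E| + |E|\<^sup>2 / q\<^sup>k)\<close>. Subtracting the first lower bound from the total leaves an
  excess of at most \<open>|G(k,n)| |E|\<^sup>2 / q\<^sup>k\<close>, subtracting the second one at most \<open>|G(k,n)| |E|\<close>; in
  both cases an exceptional \<open>V\<close> contributes at least \<open>3|E|\<^sup>2 / 4u\<close>.

  The sizes of Grassmannians come from counting ordered bases: a space with \<open>N\<close> elements has
  \<open>\<Prod>\<^sub>i\<^sub><\<^sub>k (N - q\<^sup>i)\<close> linearly independent \<open>k\<close>-tuples.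
\<close>

section \<open>Independent tuples and subspaces over a finite field\<close>

context vectorspace
begin

text \<open>Coordinates with respect to \<open>S\<close> identify the span with the coefficient
  functions on \<open>S\<close>. Taking these extensional removes the arbitrary values off
  \<open>S\<close>, so that independence makes the map injective.\<close>

lemma card_span_lin_indpt:
  assumes "finite S" "S \<subseteq> carrier V" "lin_indpt S"
  shows "card (span S) = card (carrier K) ^ card S"
proof -
  let ?C = "S \<rightarrow>\<^sub>E carrier K"
  have im: "span S = (\<lambda>a. lincomb a S) ` ?C"
  proof -
    have "lincomb a S \<in> (\<lambda>a. lincomb a S) ` ?C" if "a \<in> S \<rightarrow> carrier K" for a
    proof (rule image_eqI)
      show "lincomb a S = lincomb (restrict a S) S"
        using that assms by (intro lincomb_restrict) auto
      show "restrict a S \<in> ?C" using that by auto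
    qed
    then show ?thesis
      unfolding finite_span[OF assms(1,2)] by (auto simp: PiE_def)
  qed
  have "inj_on (\<lambda>a. lincomb a S) ?C"
  proof (rule inj_onI)
    fix a b assume a: "a \<in> ?C" and b: "b \<in> ?C" and eq: "lincomb a S = lincomb b S"
    have ab: "a \<in> S \<rightarrow> carrier K" "b \<in> S \<rightarrow> carrier K" using a b by auto
    have "lincomb (\<lambda>v. a v \<ominus>\<^bsub>K\<^esub> b v) S = lincomb a S \<ominus>\<^bsub>V\<^esub> lincomb b S"
      using assms ab by (intro lincomb_diff) auto
    also have "\<dots> = \<zero>\<^bsub>V\<^esub>"
      using eq assms ab by (simp add: M.minus_eq M.r_neg)
    finally have "(\<lambda>v. a v \<ominus>\<^bsub>K\<^esub> b v) \<in> S \<rightarrow> {\<zero>\<^bsub>K\<^esub>}"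
      using assms ab by (intro not_lindepD[of S S]) auto
    then have "a v = b v" if "v \<in> S" for v
      using that ab R.r_right_minus_eq by (auto simp: Pi_def)
    then show "a = b" using a b by (intro PiE_ext) auto
  qed
  then show ?thesis
    using assms by (simp add: im card_image card_PiE)
qed

text \<open>Tuples are ordered so that they can be counted by prepending one vector at a time.
  Distinctness is a separate condition because \<open>lin_indpt (set bs)\<close> does not see
  repetitions.\<close>

definition indep_lists :: "'c set \<Rightarrow> nat \<Rightarrow> 'c list set" where
  "indep_lists W k = {bs. length bs = k \<and> distinct bs \<and> set bs \<subseteq> W \<and> lin_indpt (set bs)}"

lemma lin_indpt_insert:
  assumes "finite S" "S \<subseteq> carrier V" "v \<in> carrier V"
  shows "v \<notin> S \<and> lin_indpt (insert v S) \<longleftrightarrow> v \<notin> span S \<and> lin_indpt S"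
proof (cases "v \<in> S \<or> lin_dep S")
  case True
  then show ?thesis
    using in_own_span[OF assms(2)] supset_ld_is_ld[of S "insert v S"] by auto
next
  case False
  then show ?thesis
    using lin_dep_iff_in_span[OF assms(2) _ assms(3)] by auto
qed

lemma finite_indep_lists:
  assumes "finite W"
  shows "finite (indep_lists W k)"
  by (rule finite_subset[OF _ finite_lists_length_eq[OF assms, of k]])
    (auto simp: indep_lists_def)

text \<open>An independent list of length \<open>k\<close> spans \<open>card (carrier K) ^ k\<close>
  vectors of \<open>W\<close>, and exactly the remaining ones can be prepended. Natural-number
  subtraction gives a factor 0 once the span fills \<open>W\<close>, which is the right count for
  longer lists.\<close>

lemma card_indep_lists:
  assumes "submodule K W V" "finite W"
  shows "card (indep_lists W k) = (\<Prod>i<k. card W - card (carrier K) ^ i)"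
proof (induction k)
  case 0
  have "lin_indpt {}" by (auto simp: lin_dep_def)
  then have "indep_lists W 0 = {[]}" by (auto simp: indep_lists_def)
  then show ?case by simp
next
  case (Suc k)
  have W: "W \<subseteq> carrier V" using assms(1) by (rule submodule.subset)
  let ?S = "SIGMA bs : indep_lists W k. W - span (set bs)"
  have "indep_lists W (Suc k) = (\<lambda>(bs, b). b # bs) ` ?S"
  proof -
    have "b # bs \<in> indep_lists W (Suc k) \<longleftrightarrow> (bs, b) \<in> ?S" for b bs
      using lin_indpt_insert[of "set bs" b] W by (auto simp: indep_lists_def)
    moreover have "\<exists>b bs. cs = b # bs" if "cs \<in> indep_lists W (Suc k)" for cs
      using that by (cases cs) (auto simp: indep_lists_def)
    ultimately show ?thesis by force
  qed
  moreover have "inj_on (\<lambda>(bs, b). b # bs) ?S" by (auto simp: inj_on_def)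
  ultimately have "card (indep_lists W (Suc k)) = card ?S" by (simp add: card_image)
  also have "\<dots> = (\<Sum>bs\<in>indep_lists W k. card (W - span (set bs)))"
    using finite_indep_lists[OF assms(2)] assms(2) by simp
  also have "\<dots> = (\<Sum>bs\<in>indep_lists W k. card W - card (carrier K) ^ k)"
  proof (rule sum.cong[OF refl])
    fix bs assume bs: "bs \<in> indep_lists W k"
    then have sub: "span (set bs) \<subseteq> W"
      by (intro span_is_subset assms) (auto simp: indep_lists_def)
    have "card (span (set bs)) = card (carrier K) ^ k"
      using card_span_lin_indpt[of "set bs"] bs W by (auto simp: indep_lists_def distinct_card)
    then show "card (W - span (set bs)) = card W - card (carrier K) ^ k"
      using sub assms(2) by (simp add: card_Diff_subset finite_subset)
  qed
  finally show ?case using Suc.IH by simp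
qed

text \<open>Dimension is encoded by cardinality, the form in which independent tuples are counted;
  \<open>subspace_dim_iff_card\<close> justifies the encoding for finite fields.\<close>

definition subspaces_of :: "'c set \<Rightarrow> nat \<Rightarrow> 'c set set" where
  "subspaces_of W k = {U. subspace K U V \<and> U \<subseteq> W \<and> card U = card (carrier K) ^ k}"

lemma two_le_card_field:
  assumes "finite (carrier K)"
  shows "2 \<le> card (carrier K)"
proof -
  have "card {\<zero>\<^bsub>K\<^esub>, \<one>\<^bsub>K\<^esub>} \<le> card (carrier K)"
    using assms by (intro card_mono) auto
  then show ?thesis by simp
qed

text \<open>The span lies inside \<open>U\<close> and has the same finite size. An ordered basis
  thus determines its subspace, which makes the classes in \<open>card_subspaces_of\<close>
  disjoint.\<close>

lemma span_indep_list:
  assumes "finite U" "subspace K U V" "card U = card (carrier K) ^ k" "bs \<in> indep_lists U k"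
  shows "span (set bs) = U"
proof (rule card_subset_eq[OF assms(1)])
  have U: "submodule K U V" using assms(2) by simp
  show "span (set bs) \<subseteq> U"
    using assms(4) by (intro span_is_subset U) (auto simp: indep_lists_def)
  show "card (span (set bs)) = card U"
    using card_span_lin_indpt[of "set bs"] assms submodule.subset[OF U]
    by (auto simp: indep_lists_def distinct_card)
qed

text \<open>Sort the independent \<open>k\<close>-tuples of \<open>W\<close> by their span: each
  belongs to exactly one subspace, and all these subspaces have equally many ordered bases. The
  product form avoids division of natural numbers.\<close>

lemma card_subspaces_of:
  assumes "submodule K W V" "finite W"
  shows "card (subspaces_of W k) * (\<Prod>i<k. card (carrier K) ^ k - card (carrier K) ^ i)
    = (\<Prod>i<k. card W - card (carrier K) ^ i)"
proof -
  have W: "W \<subseteq> carrier V" using assms(1) by (rule submodule.subset)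
  have fin: "finite (subspaces_of W k)"
    using assms(2) by (auto simp: subspaces_of_def intro: finite_subset[of _ "Pow W"])
  have "indep_lists W k = (\<Union>U\<in>subspaces_of W k. indep_lists U k)"
  proof (intro equalityI subsetI)
    fix bs assume bs: "bs \<in> indep_lists W k"
    then have sub: "set bs \<subseteq> carrier V" using W by (auto simp: indep_lists_def)
    have "span (set bs) \<subseteq> W"
      using bs by (intro span_is_subset assms) (auto simp: indep_lists_def)
    then have "span (set bs) \<in> subspaces_of W k"
      using bs sub span_is_subspace[OF sub] card_span_lin_indpt[of "set bs"]
      by (auto simp: subspaces_of_def indep_lists_def distinct_card)
    moreover have "bs \<in> indep_lists (span (set bs)) k"
      using bs in_own_span[OF sub] by (auto simp: indep_lists_def)
    ultimately show "bs \<in> (\<Union>U\<in>subspaces_of W k. indep_lists U k)" by blast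
  qed (auto simp: subspaces_of_def indep_lists_def)
  also have "card \<dots> = (\<Sum>U\<in>subspaces_of W k. card (indep_lists U k))"
  proof (rule card_UN_disjoint[OF fin])
    show "\<forall>U\<in>subspaces_of W k. finite (indep_lists U k)"
      using assms(2) by (auto simp: subspaces_of_def intro: finite_indep_lists finite_subset)
    show "\<forall>U\<in>subspaces_of W k. \<forall>U'\<in>subspaces_of W k. U \<noteq> U' \<longrightarrow>
        indep_lists U k \<inter> indep_lists U' k = {}"
    proof (intro ballI impI, rule ccontr)
      fix U U' assume U: "U \<in> subspaces_of W k" "U' \<in> subspaces_of W k" "U \<noteq> U'"
        and "indep_lists U k \<inter> indep_lists U' k \<noteq> {}"
      then obtain bs where "bs \<in> indep_lists U k" "bs \<in> indep_lists U' k" by blast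
      then have "span (set bs) = U" "span (set bs) = U'"
        using U(1,2) assms(2) span_indep_list finite_subset unfolding subspaces_of_def
        by blast+
      with U(3) show False by simp
    qed
  qed
  also have "\<dots> = (\<Sum>U\<in>subspaces_of W k. \<Prod>i<k. card (carrier K) ^ k - card (carrier K) ^ i)"
  proof (rule sum.cong[OF refl])
    fix U assume "U \<in> subspaces_of W k"
    then have "submodule K U V" "finite U" "card U = card (carrier K) ^ k"
      using assms(2) by (auto simp: subspaces_of_def intro: finite_subset)
    then show "card (indep_lists U k) = (\<Prod>i<k. card (carrier K) ^ k - card (carrier K) ^ i)"
      by (simp add: card_indep_lists)
  qed
  finally show ?thesis using card_indep_lists[OF assms] by simp
qed

lemma card_eq_power_dim:
  assumes "finite (carrier V)" 
  shows "card (carrier V) = card (carrier K) ^ dim"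
proof -
  have "fin_dim"
    using assms in_own_span[of "carrier V"] span_is_subset2[of "carrier V"]
    unfolding fin_dim_def by blast
  then obtain B where B: "finite B" "basis B" using finite_basis_exists by blast
  then show ?thesis
    using card_span_lin_indpt[of B] dim_basis[OF B] by (auto simp: basis_def)
qed

text \<open>A finite field has at least two elements, so a power of its size determines the
  exponent.\<close>

lemma subspace_dim_iff_card:
  assumes "finite (carrier K)" "subspace K U V" "finite U"
  shows "vectorspace.dim K (vs U) = k \<longleftrightarrow> card U = card (carrier K) ^ k"
proof -
  interpret U: vectorspace K "vs U" using assms(2) by (rule subspace_is_vs)
  have "card U = card (carrier K) ^ vectorspace.dim K (vs U)"
    using U.card_eq_power_dim assms(3) by simp
  then show ?thesis
    using two_le_card_field[OF assms(1)] by (simp add: power_inject_exp)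
qed

end

section \<open>Cosets, and pairs of points with equal image\<close>

lemma (in module) a_l_coset_eq_iff:
  assumes "submodule R N M" "x \<in> carrier M" "y \<in> carrier M"
  shows "x <+\<^bsub>M\<^esub> N = y <+\<^bsub>M\<^esub> N \<longleftrightarrow> x \<ominus>\<^bsub>M\<^esub> y \<in> N"
proof -
  note N = submodule.subset[OF assms(1)]
  have neg: "\<ominus>\<^bsub>M\<^esub> h \<in> N" if "h \<in> N" for h
    using submodule.smult_closed[OF assms(1) _ that, of "\<ominus>\<^bsub>R\<^esub> \<one>\<^bsub>R\<^esub>"] smult_minus_1[of h] N that by auto
  have sub: "a <+\<^bsub>M\<^esub> N \<subseteq> b <+\<^bsub>M\<^esub> N"
    if ab: "a \<in> carrier M" "b \<in> carrier M" "a \<ominus>\<^bsub>M\<^esub> b \<in> N" for a b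
  proof
    fix v assume "v \<in> a <+\<^bsub>M\<^esub> N"
    then obtain h where h: "h \<in> N" "v = a \<oplus>\<^bsub>M\<^esub> h" by (auto simp: a_l_coset_def')
    then have "v = b \<oplus>\<^bsub>M\<^esub> ((a \<ominus>\<^bsub>M\<^esub> b) \<oplus>\<^bsub>M\<^esub> h)"
      using ab(1,2) subsetD[OF N h(1)] by (simp add: M.minus_eq M.a_assoc M.a_lcomm[of b a] M.r_neg2)
    moreover have "(a \<ominus>\<^bsub>M\<^esub> b) \<oplus>\<^bsub>M\<^esub> h \<in> N"
      using ab(3) h(1) by (rule submodule.m_closed[OF assms(1)])
    ultimately show "v \<in> b <+\<^bsub>M\<^esub> N" by (auto simp: a_l_coset_def')
  qed
  show ?thesis
  proof
    assume eq: "x <+\<^bsub>M\<^esub> N = y <+\<^bsub>M\<^esub> N"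
    have "x \<oplus>\<^bsub>M\<^esub> \<zero>\<^bsub>M\<^esub> \<in> x <+\<^bsub>M\<^esub> N"
      using submodule.zero_closed[OF assms(1)] by (auto simp: a_l_coset_def')
    then obtain h where h: "h \<in> N" "x = y \<oplus>\<^bsub>M\<^esub> h"
      using assms(2) unfolding eq by (auto simp: a_l_coset_def')
    then have "x \<ominus>\<^bsub>M\<^esub> y = h"
      using assms(3) subsetD[OF N h(1)] by (simp add: M.minus_eq M.a_comm[of y h] M.a_assoc M.r_neg)
    with h(1) show "x \<ominus>\<^bsub>M\<^esub> y \<in> N" by simp
  next
    assume d: "x \<ominus>\<^bsub>M\<^esub> y \<in> N"
    moreover have "y \<ominus>\<^bsub>M\<^esub> x = \<ominus>\<^bsub>M\<^esub> (x \<ominus>\<^bsub>M\<^esub> y)"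
      using assms by (simp add: M.minus_eq M.minus_add M.a_comm)
    ultimately have "y \<ominus>\<^bsub>M\<^esub> x \<in> N" using neg by simp
    with d show "x <+\<^bsub>M\<^esub> N = y <+\<^bsub>M\<^esub> N" using sub assms by blast
  qed
qed

text \<open>Cauchy--Schwarz for the fibre sizes of \<open>f\<close>: they add up to
  \<open>card E\<close>, and their squares add up to the number of pairs with equal image.\<close>

lemma card_squared_le_card_image_times_fibre_pairs:
  assumes "finite E"
  shows "card E ^ 2 \<le> card (f ` E) * card {(x, y) \<in> E \<times> E. f x = f y}"
proof -
  let ?n = "\<lambda>c. card {x \<in> E. f x = c}"
  have E: "card E = (\<Sum>c\<in>f ` E. ?n c)"
    using sum.image_gen[OF assms, of "\<lambda>_. 1 :: nat" f] by simp
  have "{(x, y) \<in> E \<times> E. f x = f y} = (\<Union>c\<in>f ` E. {x \<in> E. f x = c} \<times> {x \<in> E. f x = c})"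
    by auto
  also have "card \<dots> = (\<Sum>c\<in>f ` E. card ({x \<in> E. f x = c} \<times> {x \<in> E. f x = c}))"
    using assms by (intro card_UN_disjoint) auto
  also have "\<dots> = (\<Sum>c\<in>f ` E. ?n c ^ 2)"
    by (simp add: card_cartesian_product power2_eq_square)
  finally have pairs: "card {(x, y) \<in> E \<times> E. f x = f y} = (\<Sum>c\<in>f ` E. ?n c ^ 2)" .
  have "(\<Sum>c\<in>f ` E. real (?n c))\<^sup>2 \<le> (\<Sum>c\<in>f ` E. (real (?n c))\<^sup>2) * real (card (f ` E))"
    by (rule sum_squared_le_sum_of_squares)
  then have "real (card E ^ 2) \<le> real (card (f ` E) * card {(x, y) \<in> E \<times> E. f x = f y})"
    unfolding pairs E by (simp add: mult.commute)
  then show ?thesis by (simp only: of_nat_le_iff)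
qed

section \<open>The dot product and orthogonal complements\<close>

locale finite_coord_space =
  fixes F :: "('a, 'b) ring_scheme" (structure) and n :: nat
  assumes field: "field F" and finite_field: "finite (carrier F)"
begin

abbreviation "V \<equiv> coord_space F n"
abbreviation "q \<equiv> card (carrier F)"

sublocale vectorspace F V
  by (rule coord_space_vectorspace[OF field])

lemma carrier_V: "carrier V = {..<n} \<rightarrow>\<^sub>E carrier F"
  by (simp add: func_space_def)

lemma coord_closed: "x \<in> carrier V \<Longrightarrow> i < n \<Longrightarrow> x i \<in> carrier F"
  by (auto simp: carrier_V)

lemma finite_V: "finite (carrier V)"
  by (simp add: carrier_V finite_PiE finite_field)

lemma card_V: "card (carrier V) = q ^ n"
  by (simp add: carrier_V card_PiE)

lemma two_le_q: "2 \<le> q"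
  by (rule two_le_card_field[OF finite_field])

lemma dot_closed: "x \<in> carrier V \<Longrightarrow> y \<in> carrier V \<Longrightarrow> dot F n x y \<in> carrier F"
  unfolding dot_def by (intro R.finsum_closed) (auto simp: coord_closed)

lemma dot_commute: "x \<in> carrier V \<Longrightarrow> y \<in> carrier V \<Longrightarrow> dot F n x y = dot F n y x"
  unfolding dot_def by (intro R.finsum_cong') (auto simp: coord_closed R.m_comm)

lemma dot_add_right:
  assumes "x \<in> carrier V" "y \<in> carrier V" "z \<in> carrier V"
  shows "dot F n z (x \<oplus>\<^bsub>V\<^esub> y) = dot F n z x \<oplus> dot F n z y"
proof -
  have "dot F n z (x \<oplus>\<^bsub>V\<^esub> y) = (\<Oplus>i\<in>{..<n}. z i \<otimes> x i \<oplus> z i \<otimes> y i)"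
    unfolding dot_def using assms
    by (intro R.finsum_cong') (auto simp: coord_closed func_space_def R.r_distr PiE_mem)
  also have "\<dots> = dot F n z x \<oplus> dot F n z y"
    unfolding dot_def using assms by (intro R.finsum_addf) (auto simp: coord_closed)
  finally show ?thesis .
qed

lemma dot_smult_right:
  assumes "c \<in> carrier F" "x \<in> carrier V" "z \<in> carrier V"
  shows "dot F n z (c \<odot>\<^bsub>V\<^esub> x) = c \<otimes> dot F n z x"
proof -
  have "dot F n z (c \<odot>\<^bsub>V\<^esub> x) = (\<Oplus>i\<in>{..<n}. c \<otimes> (z i \<otimes> x i))"
    unfolding dot_def using assms
    by (intro R.finsum_cong') (auto simp: coord_closed func_space_def PiE_mem R.m_ac)
  also have "\<dots> = c \<otimes> dot F n z x"
    unfolding dot_def using assms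
    by (intro R.finsum_rdistr[symmetric]) (auto simp: coord_closed)
  finally show ?thesis .
qed

lemma dot_minus_right:
  assumes "x \<in> carrier V" "y \<in> carrier V" "z \<in> carrier V"
  shows "dot F n z (x \<ominus>\<^bsub>V\<^esub> y) = dot F n z x \<ominus> dot F n z y"
proof -
  have "x \<ominus>\<^bsub>V\<^esub> y = x \<oplus>\<^bsub>V\<^esub> (\<ominus> \<one>) \<odot>\<^bsub>V\<^esub> y"
    using assms by (simp add: M.minus_eq smult_minus_1)
  then show ?thesis
    using assms by (simp add: dot_add_right dot_smult_right dot_closed R.minus_eq R.l_minus)
qed

text \<open>Stated for sets rather than subspaces, so that it also applies to the complement of a
  single vector.\<close>

lemma perp_submodule:
  assumes "S \<subseteq> carrier V"
  shows "submodule F (perp F n S) V"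
proof (unfold_locales)
  show "\<zero>\<^bsub>V\<^esub> \<in> perp F n S"
    using assms dot_smult_right[of \<zero> "\<zero>\<^bsub>V\<^esub>"] dot_closed
    by (auto simp: perp_def subset_iff)
qed (use assms in \<open>auto simp: perp_def dot_add_right dot_smult_right subset_iff\<close>)

text \<open>If \<open>z i \<noteq> \<zero>\<close>, the equation of the hyperplane determines
  coordinate \<open>i\<close> from the others, so deleting that coordinate is injective on
  it.\<close>

lemma card_perp_le:
  assumes z: "z \<in> carrier V" "z \<noteq> \<zero>\<^bsub>V\<^esub>"
  shows "card (perp F n {z}) \<le> q ^ (n - 1)"
proof -
  have "\<exists>i<n. z i \<noteq> \<zero>"
  proof (rule ccontr)
    assume "\<not> ?thesis"
    then have "z = \<zero>\<^bsub>V\<^esub>"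
      using z(1) by (auto simp: carrier_V func_space_def PiE_def extensional_def fun_eq_iff)
    with z(2) show False ..
  qed
  then obtain i where i: "i < n" "z i \<noteq> \<zero>" by blast
  let ?I = "{..<n} - {i}"
  have inj: "inj_on (\<lambda>x. restrict x ?I) (perp F n {z})"
  proof (rule inj_onI)
    fix x y assume x: "x \<in> perp F n {z}" and y: "y \<in> perp F n {z}"
      and eq: "restrict x ?I = restrict y ?I"
    have xy: "x \<in> carrier V" "y \<in> carrier V" using x y by (auto simp: perp_def)
    have off: "x j = y j" if "j \<in> ?I" for j
      using fun_cong[OF eq, of j] that by simp
    have split: "dot F n z w = z i \<otimes> w i \<oplus> (\<Oplus>j\<in>?I. z j \<otimes> w j)" if "w \<in> carrier V" for w
    proof -
      have "{..<n} = insert i ?I" using i(1) by auto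
      then have "dot F n z w = (\<Oplus>j\<in>insert i ?I. z j \<otimes> w j)" unfolding dot_def by simp
      also have "\<dots> = z i \<otimes> w i \<oplus> (\<Oplus>j\<in>?I. z j \<otimes> w j)"
        using that i(1) z(1) by (intro R.finsum_insert) (auto simp: coord_closed)
      finally show ?thesis .
    qed
    have "(\<Oplus>j\<in>?I. z j \<otimes> x j) = (\<Oplus>j\<in>?I. z j \<otimes> y j)"
      using off xy z(1) by (intro R.finsum_cong') (auto simp: coord_closed)
    moreover have "(\<Oplus>j\<in>?I. z j \<otimes> y j) \<in> carrier F"
      using xy z(1) by (intro R.finsum_closed) (auto simp: coord_closed)
    moreover have "dot F n z x = dot F n z y" using x y by (simp add: perp_def)
    ultimately have "z i \<otimes> x i = z i \<otimes> y i"
      using xy z(1) i(1) by (simp add: split coord_closed)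
    then have "x i = y i"
      using i z(1) xy by (simp add: coord_closed m_lcancel)
    with off have "x j = y j" if "j < n" for j using that by (cases "j = i") auto
    then show "x = y" using xy by (intro PiE_ext[of x "{..<n}" _ y]) (auto simp: carrier_V)
  qed
  have "card (perp F n {z}) \<le> card (?I \<rightarrow>\<^sub>E carrier F)"
  proof (rule card_inj_on_le[OF inj])
    show "(\<lambda>x. restrict x ?I) ` perp F n {z} \<subseteq> ?I \<rightarrow>\<^sub>E carrier F"
      by (intro image_subsetI restrict_PiE_iff[THEN iffD2]) (simp add: perp_def coord_closed)
  qed (simp add: finite_PiE finite_field)
  also have "\<dots> = q ^ (n - 1)" using i(1) by (simp add: card_PiE)
  finally show ?thesis .
qed

section \<open>Sizes of Grassmannians and incidence with a vector\<close>

lemma Grassmannian_eq: "Grassmannian F k n = subspaces_of (carrier V) k"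
proof -
  have "U \<subseteq> carrier V" "finite U" if "subspace F U V" for U
    using submodule.subset[OF is_module[OF that]] finite_V by (auto intro: finite_subset)
  then show ?thesis
    using subspace_dim_iff_card[OF finite_field]
    unfolding Grassmannian_def subspaces_of_def by blast
qed

lemma finite_Grassmannian: "finite (Grassmannian F k n)"
  unfolding Grassmannian_eq
  by (rule finite_subset[of _ "Pow (carrier V)"]) (auto simp: subspaces_of_def finite_V)

lemma card_Grassmannian:
  "card (Grassmannian F k n) * (\<Prod>i<k. q ^ k - q ^ i) = (\<Prod>i<k. q ^ n - q ^ i)"
proof -
  have "submodule F (carrier V) V" by unfold_locales auto
  from card_subspaces_of[OF this finite_V] show ?thesis
    by (simp add: Grassmannian_eq card_V)
qed

lemma Grassmannian_subset: "U \<in> Grassmannian F k n \<Longrightarrow> U \<subseteq> carrier V"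
  by (simp add: Grassmannian_eq subspaces_of_def)

text \<open>\<open>z\<close> is orthogonal to \<open>U\<close> exactly when \<open>U\<close> lies in
  the hyperplane \<open>perp F n {z}\<close>, which has at most \<open>q ^ (n - 1)\<close> elements.
  Comparing ordered bases factor by factor, each of the \<open>k\<close> choices loses a factor
  \<open>q\<close>.\<close>

lemma perp_incidence_count:
  assumes z: "z \<in> carrier V" "z \<noteq> \<zero>\<^bsub>V\<^esub>"
  shows "card {U \<in> Grassmannian F k n. z \<in> perp F n U} * q ^ k \<le> card (Grassmannian F k n)"
proof -
  let ?H = "perp F n {z}" and ?g = "\<Prod>i<k. q ^ k - q ^ i"
  have H: "submodule F ?H V" using z(1) by (intro perp_submodule) simp
  have finH: "finite ?H" using finite_V submodule.subset[OF H] by (rule rev_finite_subset)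
  have eq: "{U \<in> Grassmannian F k n. z \<in> perp F n U} = subspaces_of ?H k"
    using z(1) dot_commute by (fastforce simp: Grassmannian_eq subspaces_of_def perp_def)
  \<comment> \<open>For \<open>n = 0\<close> there is no nonzero \<open>z\<close>; excluding this
    case gives \<open>q ^ (n - 1) * q = q ^ n\<close>.\<close>
  have n: "n \<noteq> 0"
  proof
    assume "n = 0"
    then show False using z by (auto simp: func_space_def)
  qed
  \<comment> \<open>\<open>?g\<close> is the number of ordered bases of one
    \<open>k\<close>-dimensional space. The power \<open>q ^ k\<close> is distributed as one
    \<open>q\<close> per factor.\<close>
  have "card (subspaces_of ?H k) * q ^ k * ?g = (\<Prod>i<k. card ?H - q ^ i) * (\<Prod>i<k. q)"
    using card_subspaces_of[OF H finH, of k] by (simp add: mult.commute mult.left_commute)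
  also have "\<dots> = (\<Prod>i<k. (card ?H - q ^ i) * q)"
    by (simp only: prod.distrib)
  also have "\<dots> \<le> (\<Prod>i<k. q ^ n - q ^ i)"
  proof (rule prod_mono, intro conjI)
    fix i
    have "(card ?H - q ^ i) * q \<le> (q ^ (n - 1) - q ^ i) * q"
      using card_perp_le[OF z] by (intro mult_right_mono diff_le_mono) auto
    also have "\<dots> = q ^ n - q ^ i * q"
      using power_minus_mult[of n q] n by (simp only: diff_mult_distrib neq0_conv)
    also have "\<dots> \<le> q ^ n - q ^ i" using two_le_q by (intro diff_le_mono2) simp
    finally show "(card ?H - q ^ i) * q \<le> q ^ n - q ^ i" .
  qed simp
  also have "\<dots> = card (Grassmannian F k n) * ?g" by (simp add: card_Grassmannian)
  finally have "card (subspaces_of ?H k) * q ^ k * ?g \<le> card (Grassmannian F k n) * ?g" .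
  moreover have "?g > 0"
    using two_le_q by (intro prod_pos) (auto intro: power_strict_increasing)
  ultimately show ?thesis unfolding eq by simp
qed

section \<open>Projections as images of the point set\<close>

lemma proj_eq_image:
  assumes "U \<subseteq> carrier V" "E \<subseteq> carrier V"
  shows "proj F n U E = (\<lambda>x. x <+\<^bsub>V\<^esub> perp F n U) ` E"
proof -
  let ?P = "perp F n U"
  note P = perp_submodule[OF assms(1)]
  \<comment> \<open>A coset that meets \<open>E\<close> in \<open>e\<close> is the coset of
    \<open>e\<close>.\<close>
  have "x <+\<^bsub>V\<^esub> ?P \<in> (\<lambda>x. x <+\<^bsub>V\<^esub> ?P) ` E"
    if x: "x \<in> carrier V" and e: "e \<in> x <+\<^bsub>V\<^esub> ?P" "e \<in> E" for x e
  proof -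
    obtain h where h: "h \<in> ?P" "e = x \<oplus>\<^bsub>V\<^esub> h" using e(1) by (auto simp: a_l_coset_def')
    have "h \<in> carrier V" using h(1) by (simp add: perp_def)
    then have "e \<ominus>\<^bsub>V\<^esub> x = h"
      using h(2) x by (simp add: M.minus_eq M.a_comm[of x h] M.a_assoc M.r_neg)
    then have "e <+\<^bsub>V\<^esub> ?P = x <+\<^bsub>V\<^esub> ?P"
      using a_l_coset_eq_iff[OF P, of e x] h(1) x e(2) assms(2) by blast
    then show ?thesis using e(2) by blast
  qed
  moreover have "e \<in> e <+\<^bsub>V\<^esub> ?P" if "e \<in> E" for e
  proof -
    have "e \<oplus>\<^bsub>V\<^esub> \<zero>\<^bsub>V\<^esub> \<in> e <+\<^bsub>V\<^esub> ?P"
      using submodule.zero_closed[OF P] by (auto simp: a_l_coset_def')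
    then show ?thesis using that assms(2) by auto
  qed
  ultimately show ?thesis using assms(2) unfolding proj_def by blast
qed

text \<open>The coset of \<open>x\<close> is determined by the dot products of \<open>x\<close> with
  a basis of \<open>U\<close>, and these \<open>k\<close> scalars take at most \<open>q ^ k\<close>
  values.\<close>

lemma card_proj_le:
  assumes U: "U \<in> Grassmannian F k n" and E: "E \<subseteq> carrier V"
  shows "card (proj F n U E) \<le> q ^ k"
proof -
  have Usub: "U \<subseteq> carrier V" and subsp: "subspace F U V" and cardU: "card U = q ^ k"
    using U by (auto simp: Grassmannian_eq subspaces_of_def)
  have finU: "finite U" using finite_V Usub by (rule rev_finite_subset)
  \<comment> \<open>A basis of \<open>U\<close> exists because the number of ordered bases is
    positive.\<close>
  have "card (indep_lists U k) > 0"
  proof -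
    have "card (indep_lists U k) = (\<Prod>i<k. q ^ k - q ^ i)"
      using card_indep_lists[OF is_module[OF subsp] finU] cardU by simp
    also have "\<dots> > 0"
      using two_le_q by (intro prod_pos) (auto intro: power_strict_increasing)
    finally show ?thesis .
  qed
  then obtain bs where bs: "bs \<in> indep_lists U k" by (auto simp: card_gt_0_iff)
  have span: "span (set bs) = U" by (rule span_indep_list[OF finU subsp cardU bs])
  let ?B = "set bs" and ?f = "\<lambda>x. x <+\<^bsub>V\<^esub> perp F n U"
  let ?g = "\<lambda>x. restrict (\<lambda>b. dot F n b x) ?B"
  have B: "?B \<subseteq> carrier V" "card ?B = k"
    using bs Usub by (auto simp: indep_lists_def distinct_card)
  have fg: "?f x = ?f y" if xy: "x \<in> carrier V" "y \<in> carrier V" "?g x = ?g y" for x y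
  proof -
    let ?d = "x \<ominus>\<^bsub>V\<^esub> y"
    have d: "?d \<in> carrier V" using xy by simp
    have B0: "dot F n b ?d = \<zero>" if "b \<in> ?B" for b
    proof -
      have "dot F n b x = dot F n b y" using fun_cong[OF xy(3), of b] that by simp
      then show ?thesis
        using xy that B(1) by (subst dot_minus_right) (auto simp: dot_closed R.minus_eq R.r_neg)
    qed
    \<comment> \<open>Orthogonality to \<open>?d\<close> is a linear condition, so it passes from
      the basis to its span \<open>U\<close>.\<close>
    have "?B \<subseteq> perp F n {?d}"
      using B B0 d dot_commute[OF d] by (auto simp: perp_def)
    then have "U \<subseteq> perp F n {?d}"
      unfolding span[symmetric] using d by (intro span_is_subset perp_submodule) auto
    then have "?d \<in> perp F n U"
      using Usub d dot_commute[OF d] by (fastforce simp: perp_def)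
    then show ?thesis
      using a_l_coset_eq_iff[OF perp_submodule[OF Usub] xy(1,2)] by simp
  qed
  have "card (?f ` E) \<le> card (?g ` E)"
  proof -
    \<comment> \<open>By \<open>fg\<close> the coset map factors through \<open>?g\<close> on
      \<open>E\<close>; the factor map picks a representative in each fibre of
      \<open>?g\<close>.\<close>
    have "?f ` E \<subseteq> (\<lambda>c. ?f (SOME x. x \<in> E \<and> ?g x = c)) ` ?g ` E"
    proof
      fix v assume "v \<in> ?f ` E"
      then obtain x where x: "x \<in> E" "v = ?f x" by blast
      define y where "y = (SOME y. y \<in> E \<and> ?g y = ?g x)"
      have y: "y \<in> E \<and> ?g y = ?g x"
        unfolding y_def by (rule someI[where x = x]) (use x in simp)
      then have "v = ?f y" using fg[of x y] x E by auto
      then show "v \<in> (\<lambda>c. ?f (SOME x. x \<in> E \<and> ?g x = c)) ` ?g ` E"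
        using x(1) unfolding y_def by blast
    qed
    then show ?thesis
      using finite_V E by (intro surj_card_le) (auto intro: finite_subset)
  qed
  also have "\<dots> \<le> card (?B \<rightarrow>\<^sub>E carrier F)"
    using E B by (intro card_mono) (auto simp: finite_PiE finite_field dot_closed subset_iff)
  also have "\<dots> = q ^ k" using B by (simp add: card_PiE)
  finally show ?thesis using proj_eq_image[OF Usub E] by simp
qed

end

section \<open>A lower bound for a product of differences of powers\<close>

lemma prod_one_minus_half_power_ge:
  "(1/4 :: real) + (1/2) ^ Suc (Suc m) \<le> (\<Prod>j<Suc m. 1 - (1/2) ^ Suc j)"
proof (induction m)
  case (Suc m)
  \<comment> \<open>The bare bound 1/4 would not survive multiplication by \<open>1 - t\<close>; the
    surplus \<open>t\<close> makes the induction work. Since \<open>t \<le> 1/4\<close>, at least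
    \<open>t/2\<close> of it remains, which is the next surplus. Starting from one factor ensures
    \<open>t \<le> 1/4\<close>.\<close>
  define t :: real where "t = (1/2) ^ Suc (Suc m)"
  have t: "0 \<le> t" "t \<le> 1/4"
    using power_le_one[of "1/2 :: real" m] by (simp_all add: t_def field_simps)
  then have "t * t \<le> t * (1/4)" by (intro mult_left_mono)
  moreover have "(1/4 + t) * (1 - t) = 1/4 + 3/4 * t - t * t" by (simp add: field_simps)
  ultimately have "1/4 + t/2 \<le> (1/4 + t) * (1 - t)" by linarith
  also have "\<dots> \<le> (\<Prod>j<Suc m. 1 - (1/2) ^ Suc j) * (1 - t)"
    using Suc.IH t by (intro mult_right_mono) (simp_all add: t_def)
  finally show ?case by (simp add: t_def)
qed simp

text \<open>Pulling \<open>q ^ k\<close> out of every factor leaves the product of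
  \<open>1 - (1/q) ^ j\<close> over \<open>j\<close> from 1 to \<open>k\<close>, which is smallest
  at \<open>q = 2\<close>.\<close>

lemma quarter_power_le_prod_diff:
  fixes q :: real
  assumes "2 \<le> q"
  shows "q ^ (k * k) / 4 \<le> (\<Prod>i<k. q ^ k - q ^ i)"
proof -
  have quarter: "1/4 \<le> (\<Prod>j<k. 1 - (1/q) ^ Suc j)"
  proof -
    have "1/4 \<le> (\<Prod>j<k. 1 - (1/2 :: real) ^ Suc j)"
    \<comment> \<open>The strengthened estimate starts at one factor, so the empty product is
      separate.\<close>
    proof (cases k)
      case (Suc m)
      have "(0::real) \<le> (1/2) ^ Suc (Suc m)" by simp
      with prod_one_minus_half_power_ge[of m] show ?thesis unfolding Suc by linarith
    qed simp
    also have "\<dots> \<le> (\<Prod>j<k. 1 - (1/q) ^ Suc j)"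
    proof (rule prod_mono, intro conjI)
      fix j
      have "(1/q) ^ Suc j \<le> (1/2) ^ Suc j"
        using assms by (intro power_mono) (auto simp: field_simps)
      then show "1 - (1/2 :: real) ^ Suc j \<le> 1 - (1/q) ^ Suc j" by simp
      show "0 \<le> 1 - (1/2 :: real) ^ Suc j" using power_le_one[of "1/2 :: real" "Suc j"] by simp
    qed
    finally show ?thesis .
  qed
  have "q ^ (k * k) / 4 \<le> q ^ (k * k) * (\<Prod>j<k. 1 - (1/q) ^ Suc j)"
    using mult_left_mono[OF quarter, of "q ^ (k * k)"] assms by simp
  \<comment> \<open>Reverse the index: \<open>Suc j\<close> becomes \<open>k - i\<close>.\<close>
  also have "\<dots> = (\<Prod>j<k. q ^ k) * (\<Prod>i<k. 1 - (1/q) ^ (k - i))"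
  proof -
    have "(\<Prod>j<k. 1 - (1/q) ^ Suc j) = (\<Prod>i<k. 1 - (1/q) ^ Suc (k - Suc i))"
      by (rule prod.nat_diff_reindex[symmetric])
    also have "\<dots> = (\<Prod>i<k. 1 - (1/q) ^ (k - i))"
      by (intro prod.cong refl) (simp add: Suc_diff_Suc del: power_Suc)
    finally show ?thesis by (simp add: power_mult del: power_Suc)
  qed
  also have "\<dots> = (\<Prod>i<k. q ^ k - q ^ i)"
    unfolding prod.distrib[symmetric]
  proof (rule prod.cong[OF refl])
    fix i assume "i \<in> {..<k}"
    then have "q ^ k = q ^ (k - i) * q ^ i" by (simp flip: power_add)
    then show "q ^ k * (1 - (1/q) ^ (k - i)) = q ^ k - q ^ i"
      using assms by (simp add: power_one_over field_simps)
  qed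
  finally show ?thesis .
qed

section \<open>Double counting over the Grassmannian\<close>

context finite_coord_space
begin

text \<open>In the quotient of basis counts the numerator is at most \<open>q ^ (n * k)\<close> and
  the denominator at least \<open>q ^ (k * k) / 4\<close>, whence the constant 4.\<close>

lemma card_Grassmannian_le:
  assumes "k \<le> n"
  shows "real (card (Grassmannian F k n)) \<le> 4 * real q ^ (k * (n - k))"
proof -
  let ?G = "real (card (Grassmannian F k n))"
  have "real (\<Prod>i<k. q ^ k - q ^ i) = (\<Prod>i<k. real q ^ k - real q ^ i)"
    unfolding of_nat_prod
    using two_le_q by (intro prod.cong) (auto simp: of_nat_diff power_increasing)
  then have "?G * (real q ^ (k * k) / 4) \<le> ?G * real (\<Prod>i<k. q ^ k - q ^ i)"
    using quarter_power_le_prod_diff[of "real q" k] two_le_q by (intro mult_left_mono) auto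
  also have "\<dots> = real (\<Prod>i<k. q ^ n - q ^ i)"
    using card_Grassmannian[of k] by (simp only: of_nat_mult[symmetric])
  also have "\<dots> \<le> real (\<Prod>i<k. q ^ n)"
    by (intro of_nat_mono prod_mono) auto
  also have "\<dots> = real q ^ (k * (n - k)) * real q ^ (k * k)"
    using assms by (simp flip: power_add power_mult add: algebra_simps diff_mult_distrib2)
  finally show ?thesis using two_le_q by (simp add: field_simps)
qed

text \<open>The second moment of the fibre sizes of the projection of \<open>E\<close> onto
  \<open>U\<close>, diagonal pairs included.\<close>

definition fibre_pairs :: "(nat \<Rightarrow> 'a) set \<Rightarrow> (nat \<Rightarrow> 'a) set \<Rightarrow> nat" where
  "fibre_pairs E U = card {(x, y) \<in> E \<times> E. x <+\<^bsub>V\<^esub> perp F n U = y <+\<^bsub>V\<^esub> perp F n U}"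

text \<open>Exchange the sums and count, for each pair, the subspaces that identify it: all of
  \<open>G\<close> on the diagonal, at most a proportion \<open>1 / q ^ k\<close> elsewhere.
  Multiplying by \<open>q ^ k\<close> keeps the inequality in the naturals.\<close>

lemma sum_fibre_pairs_le:
  fixes k :: nat
  assumes E: "E \<subseteq> carrier V"
  defines "G \<equiv> Grassmannian F k n"
  shows "(\<Sum>U\<in>G. fibre_pairs E U) * q ^ k \<le> card G * card E * q ^ k + card E ^ 2 * card G"
proof -
  let ?eq = "\<lambda>U x y. x <+\<^bsub>V\<^esub> perp F n U = y <+\<^bsub>V\<^esub> perp F n U"
  let ?R = "{(U, w). ?eq U (fst w) (snd w)}"
  have finE: "finite E" using finite_V E by (rule rev_finite_subset)
  have finG: "finite G" unfolding G_def by (rule finite_Grassmannian)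
  have "(\<Sum>U\<in>G. fibre_pairs E U) = (\<Sum>U\<in>G. card {w \<in> E \<times> E. (U, w) \<in> ?R})"
    by (intro sum.cong refl) (auto simp: fibre_pairs_def intro!: arg_cong[of _ _ card])
  also have "\<dots> = (\<Sum>w\<in>E \<times> E. card {U \<in> G. (U, w) \<in> ?R})"
    using finE finG by (intro sum_multicount_gen) auto
  finally have "(\<Sum>U\<in>G. fibre_pairs E U) * q ^ k
      = (\<Sum>(x, y)\<in>E \<times> E. card {U \<in> G. ?eq U x y} * q ^ k)"
    by (simp add: sum_distrib_right case_prod_unfold)
  \<comment> \<open>The off-diagonal bound \<open>card G\<close> is charged to diagonal pairs too,
    so that it sums to \<open>card E ^ 2 * card G\<close>.\<close>
  also have "\<dots> \<le> (\<Sum>(x, y)\<in>E \<times> E. (if x = y then card G * q ^ k else 0) + card G)"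
  proof (rule sum_mono, clarify)
    fix x y assume "x \<in> E" "y \<in> E"
    then have xy: "x \<in> carrier V" "y \<in> carrier V" using E by auto
    show "card {U \<in> G. ?eq U x y} * q ^ k \<le> (if x = y then card G * q ^ k else 0) + card G"
    proof (cases "x = y")
      case False
      have "{U \<in> G. ?eq U x y} = {U \<in> G. x \<ominus>\<^bsub>V\<^esub> y \<in> perp F n U}"
        using a_l_coset_eq_iff[OF perp_submodule xy] Grassmannian_subset by (auto simp: G_def)
      moreover have "x \<ominus>\<^bsub>V\<^esub> y \<noteq> \<zero>\<^bsub>V\<^esub>"
        using False xy M.minus_equality[of x "\<ominus>\<^bsub>V\<^esub> y"] by (auto simp: M.minus_eq)
      ultimately show ?thesis
        using perp_incidence_count[of "x \<ominus>\<^bsub>V\<^esub> y" k] False xy by (simp add: G_def)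
    qed simp
  qed
  also have "\<dots> = (\<Sum>x\<in>E. \<Sum>y\<in>E. (if x = y then card G * q ^ k else 0) + card G)"
    by (rule sum.cartesian_product[symmetric])
  also have "\<dots> = card E * (card G * q ^ k) + card E * card E * card G"
    using finE by (simp add: sum.distrib distrib_left)
  finally show ?thesis by (simp add: power2_eq_square mult_ac)
qed

lemma card_squared_le_proj_times_fibre_pairs:
  assumes "U \<subseteq> carrier V" "E \<subseteq> carrier V"
  shows "card E ^ 2 \<le> card (proj F n U E) * fibre_pairs E U"
  unfolding proj_eq_image[OF assms] fibre_pairs_def
  using finite_V assms(2) by (intro card_squared_le_card_image_times_fibre_pairs) (rule rev_finite_subset)

lemma card_le_fibre_pairs:
  assumes "E \<subseteq> carrier V"
  shows "card E \<le> fibre_pairs E U"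
proof -
  have "finite E" using finite_V assms by (rule rev_finite_subset)
  then show ?thesis
    unfolding fibre_pairs_def
    by (intro card_inj_on_le[of "\<lambda>x. (x, x)"])
      (auto simp: inj_on_def intro: finite_subset[of _ "E \<times> E"])
qed

lemma small_proj_mult_max_le:
  fixes u :: real
  assumes E: "E \<subseteq> carrier V" "E \<noteq> {}"
    and u: "0 < u" "u \<le> 1/4 * min (real q ^ k) (real (card E))"
  shows "real (card (small_proj F k n E u)) * max (real (card E)) (real q ^ k)
    \<le> 4/3 * u * real (card (Grassmannian F k n))"
proof -
  define G where "G = Grassmannian F k n"
  define B where "B = small_proj F k n E u"
  define e where "e = real (card E)"
  define Q where "Q = real q ^ k"
  define p where "p U = real (fibre_pairs E U)" for U
  have finE: "finite E" using finite_V E(1) by (rule rev_finite_subset)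
  have e: "e > 0" using finE E(2) by (simp add: e_def card_gt_0_iff)
  have Q: "Q > 0" using two_le_q by (simp add: Q_def)
  have finG: "finite G" unfolding G_def by (rule finite_Grassmannian)
  have BG: "B \<subseteq> G" by (auto simp: B_def G_def small_proj_def)
  have u4: "4 * u \<le> Q" "4 * u \<le> e" using u by (auto simp: Q_def e_def)
  have cs: "e\<^sup>2 \<le> real (card (proj F n U E)) * p U" if "U \<in> G" for U
    using card_squared_le_proj_times_fibre_pairs[OF Grassmannian_subset[OF that[unfolded G_def]] E(1)]
    by (simp add: e_def p_def flip: of_nat_power of_nat_mult)
  have p_bad: "e\<^sup>2 / u \<le> p U" if "U \<in> B" for U
  proof -
    have "e\<^sup>2 \<le> real (card (proj F n U E)) * p U" using cs that BG by blast
    also have "\<dots> \<le> u * p U"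
      using that by (intro mult_right_mono) (auto simp: B_def small_proj_def p_def)
    finally show ?thesis using u by (simp add: field_simps)
  qed
  have p_all: "e\<^sup>2 / Q \<le> p U" if "U \<in> G" for U
  proof -
    have "e\<^sup>2 \<le> real (card (proj F n U E)) * p U" using cs that by blast
    also have "\<dots> \<le> Q * p U"
      using card_proj_le[OF that[unfolded G_def] E(1)]
      by (intro mult_right_mono) (auto simp: Q_def p_def simp flip: of_nat_power)
    finally show ?thesis using Q by (simp add: field_simps)
  qed
  have p_diag: "e \<le> p U" for U
    using card_le_fibre_pairs[OF E(1)] by (simp add: e_def p_def)
  have sum_p: "(\<Sum>U\<in>G. p U) \<le> real (card G) * e + real (card G) * (e\<^sup>2 / Q)"
  proof -
    have "real ((\<Sum>U\<in>G. fibre_pairs E U) * q ^ k)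
        \<le> real (card G * card E * q ^ k + card E ^ 2 * card G)"
      using sum_fibre_pairs_le[OF E(1), of k] unfolding G_def by (intro of_nat_mono)
    then have "(\<Sum>U\<in>G. p U) * Q \<le> real (card G) * e * Q + e\<^sup>2 * real (card G)"
      by (simp add: p_def Q_def e_def)
    then show ?thesis using Q by (simp add: field_simps)
  qed
  \<comment> \<open>For any common lower bound \<open>c\<close> the terms \<open>p U - c\<close> are
    nonnegative on \<open>G\<close>, so their sum dominates the part over \<open>B\<close>, where
    \<open>p_bad\<close> applies.\<close>
  have excess: "real (card B) * (e\<^sup>2 / u - c) \<le> (\<Sum>U\<in>G. p U) - real (card G) * c"
    if "\<And>U. U \<in> G \<Longrightarrow> c \<le> p U" for c
  proof -
    have "real (card B) * (e\<^sup>2 / u - c) \<le> (\<Sum>U\<in>B. p U - c)"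
      using p_bad by (intro sum_bounded_below) auto
    also have "\<dots> \<le> (\<Sum>U\<in>G. p U - c)"
      using that by (intro sum_mono2 finG BG) auto
    finally show ?thesis by (simp add: sum_subtractf)
  qed
  \<comment> \<open>This is where the 1/4 in the hypothesis on \<open>u\<close> enters: a baseline
    \<open>c\<close> is at most a quarter of \<open>e\<^sup>2 / u\<close>, leaving 3/4 and later the
    constant 4/3.\<close>
  have gap: "3/4 * (e\<^sup>2 / u) \<le> e\<^sup>2 / u - c" if "c * (4 * u) \<le> e\<^sup>2" for c
    using that u by (simp add: field_simps)
  \<comment> \<open>Baseline \<open>e\<close>, admissible since \<open>4 * u \<le> e\<close>: it
    cancels the diagonal term of \<open>sum_p\<close> and yields the bound with
    \<open>Q\<close>.\<close>
  have "real (card B) * (3/4 * (e\<^sup>2 / u)) \<le> real (card B) * (e\<^sup>2 / u - e)"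
    using u4 e by (intro mult_left_mono gap) (auto simp: power2_eq_square)
  also have "\<dots> \<le> real (card G) * (e\<^sup>2 / Q)"
    using excess[of e] p_diag sum_p by auto
  finally have bQ: "real (card B) * Q \<le> 4/3 * u * real (card G)"
    using e Q u by (simp add: field_simps power2_eq_square)
  \<comment> \<open>Baseline \<open>e\<^sup>2 / Q\<close>, admissible since
    \<open>4 * u \<le> Q\<close>: it cancels the other term and yields the bound with
    \<open>e\<close>.\<close>
  have "real (card B) * (3/4 * (e\<^sup>2 / u)) \<le> real (card B) * (e\<^sup>2 / u - e\<^sup>2 / Q)"
    using mult_right_mono[OF u4(1), of "e\<^sup>2"] Q
    by (intro mult_left_mono gap) (auto simp: field_simps)
  also have "\<dots> \<le> real (card G) * e"
    using excess[of "e\<^sup>2 / Q"] p_all sum_p by auto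
  finally have be: "real (card B) * e \<le> 4/3 * u * real (card G)"
    using e u by (simp add: field_simps power2_eq_square)
  show ?thesis
    using bQ be by (simp add: max_def B_def G_def e_def Q_def)
qed

end

section \<open>From field records to the absolute and the asymptotic bound\<close>

lemma GF_finite_coord_space:
  assumes "GF q F"
  shows "finite_coord_space F"
proof -
  \<comment> \<open>Infinite sets have \<open>card\<close> 0, so a positive value forces
    finiteness.\<close>
  have "card (carrier F) > 0" using assms primepow_gt_0_nat by (auto simp: GF_def)
  then show ?thesis
    using assms by (auto simp: finite_coord_space_def GF_def intro: card_ge_0_finite)
qed

theorem corollary3p5:
  shows
    "(\<exists>C::real. C > 0 \<and>
        (\<forall>(q::nat) (F::nat ring) (n::nat) (k::nat) (E::(nat \<Rightarrow> nat) set) (u::real).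
           GF q F \<longrightarrow> n \<ge> 1 \<longrightarrow> k \<le> n \<longrightarrow>
           E \<subseteq> carrier (coord_space F n) \<longrightarrow> E \<noteq> {} \<longrightarrow>
           0 < u \<longrightarrow> u \<le> 1/4 * min (real q ^ k) (real (card E)) \<longrightarrow>
           real (card (small_proj F k n E u))
             \<le> C * (u * real q ^ (k * (n - k)) / max (real (card E)) (real q ^ k))))
     \<and>
     (\<forall>(n::nat) (k::nat) (Q::nat set) (F::nat \<Rightarrow> nat ring)
        (E::nat \<Rightarrow> (nat \<Rightarrow> nat) set) (u::nat \<Rightarrow> real).
        n \<ge> 1 \<longrightarrow> k \<le> n \<longrightarrow> infinite Q \<longrightarrow>
        (\<forall>q\<in>Q. GF q (F q) \<and> E q \<subseteq> carrier (coord_space (F q) n) \<and> E q \<noteq> {} \<and>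
           0 < u q \<and> u q \<le> 1/4 * min (real q ^ k) (real (card (E q)))) \<longrightarrow>
        little_o_on Q u (\<lambda>q. max (real (card (E q))) (real q ^ k)) \<longrightarrow>
        little_o_on Q (\<lambda>q. real (card (small_proj (F q) k n (E q) (u q))))
                      (\<lambda>q. real (card (Grassmannian (F q) k n))))"
proof (intro conjI exI[of _ "16/3"] allI impI)
  fix q :: nat and F :: "nat ring" and n k :: nat and E :: "(nat \<Rightarrow> nat) set" and u :: real
  assume GF: "GF q F" and k: "k \<le> n" and E: "E \<subseteq> carrier (coord_space F n)" "E \<noteq> {}"
    and u: "0 < u" "u \<le> 1/4 * min (real q ^ k) (real (card E))"
  interpret finite_coord_space F n by (rule GF_finite_coord_space[OF GF])
  have q: "card (carrier F) = q" using GF by (simp add: GF_def)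
  define m where "m = max (real (card E)) (real q ^ k)"
  have m: "m > 0" using two_le_q unfolding q by (simp add: m_def less_max_iff_disj)
  \<comment> \<open>The witness 16/3 is 4/3 from the double count times 4 from the size of the
    Grassmannian.\<close>
  have "real (card (small_proj F k n E u)) * m \<le> 4/3 * u * real (card (Grassmannian F k n))"
    using small_proj_mult_max_le[OF E, of u k] u by (simp add: m_def q)
  also have "\<dots> \<le> 4/3 * u * (4 * real q ^ (k * (n - k)))"
    using card_Grassmannian_le[OF k] u by (intro mult_left_mono) (auto simp: q)
  finally show "real (card (small_proj F k n E u))
      \<le> 16/3 * (u * real q ^ (k * (n - k)) / max (real (card E)) (real q ^ k))"
    unfolding m_def[symmetric] using m by (simp add: field_simps)
next
  fix n k :: nat and Q :: "nat set" and F :: "nat \<Rightarrow> nat ring"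
    and E :: "nat \<Rightarrow> (nat \<Rightarrow> nat) set" and u :: "nat \<Rightarrow> real"
  let ?m = "\<lambda>q. max (real (card (E q))) (real q ^ k)"
  let ?b = "\<lambda>q. real (card (small_proj (F q) k n (E q) (u q)))"
  let ?g = "\<lambda>q. real (card (Grassmannian (F q) k n))"
  assume hyp: "\<forall>q\<in>Q. GF q (F q) \<and> E q \<subseteq> carrier (coord_space (F q) n) \<and> E q \<noteq> {} \<and>
      0 < u q \<and> u q \<le> 1/4 * min (real q ^ k) (real (card (E q)))"
    and small: "little_o_on Q u ?m"
  from small have lim: "((\<lambda>q. 4/3 * (u q / ?m q)) \<longlongrightarrow> 0) (inf at_top (principal Q))"
    unfolding little_o_on_def by (rule tendsto_mult_right_zero)
  \<comment> \<open>The double count is already relative to the size of the Grassmannian, so the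
    ratio is bounded directly by a multiple of \<open>u q / ?m q\<close>.\<close>
  have bound: "?b q / ?g q \<le> 4/3 * (u q / ?m q)" if "q \<in> Q" for q
  proof -
    from hyp that have GF: "GF q (F q)" and E: "E q \<subseteq> carrier (coord_space (F q) n)" "E q \<noteq> {}"
      and u: "0 < u q" "u q \<le> 1/4 * min (real q ^ k) (real (card (E q)))" by auto
    interpret finite_coord_space "F q" n by (rule GF_finite_coord_space[OF GF])
    have q: "card (carrier (F q)) = q" using GF by (simp add: GF_def)
    have m: "?m q > 0" using two_le_q unfolding q by (simp add: less_max_iff_disj)
    have le: "?b q * ?m q \<le> 4/3 * u q * ?g q"
      using small_proj_mult_max_le[OF E, of "u q" k] u by (simp add: q)
    \<comment> \<open>For \<open>?g q = 0\<close> the quotient is 0 by convention and only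
      nonnegativity of the right side remains.\<close>
    show ?thesis
    proof (cases "?g q = 0")
      case True
      then show ?thesis using m u by simp
    next
      case False
      then show ?thesis using le m by (simp add: field_simps)
    qed
  qed
  show "little_o_on Q ?b ?g"
    unfolding little_o_on_def
  proof (rule tendsto_sandwich[OF _ _ tendsto_const lim])
    show "\<forall>\<^sub>F q in inf at_top (principal Q). 0 \<le> ?b q / ?g q" by simp
    show "\<forall>\<^sub>F q in inf at_top (principal Q). ?b q / ?g q \<le> 4/3 * (u q / ?m q)"
      using bound by (auto simp: eventually_inf_principal)
  qed
qed simp

end
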